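(* Let $\mu_1,\mu_2$ be weakly mixing shift-invariant Borel probability measures on $\mathbb{N}_2^{\mathbb{N}}$, neither of which is positive on $\{2\}$. Put $\mu=\mu_1\times\mu_2$, let $\alpha\in(0,1)$, and suppose that $$\max\left(\int\log\pi_1(\omega)\,d\mu(\omega),\int\log\pi_2(\omega)\,d\mu(\omega)\right)<\infty.$$ If $\int\log\pi_2(\omega)\,d\mu(\omega)>\alpha\int\log\pi_1(\omega)\,d\mu(\omega)$, then for $\mu$-almost every $(P,Q)\in\mathbb{N}_2^{\mathbb{N}}\times\mathbb{N}_2^{\mathbb{N}}$, $\phi_{P,Q}^{(k)}$ is H\"older continuous of exponent $\alpha$ for all integers $k\ge0$. If $\int\log\pi_2(\omega)\,d\mu(\omega)>\int\log\pi_1(\omega)\,d\mu(\omega)$, then for $\mu$-almost every $(P,Q)$, $\phi_{P,Q}^{(k)}$ is Lipschitz continuous for all integers $k\ge0$.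
   Context: $\mathbb{N}_2=\{2,3,4,\ldots\}$; elements of $\mathbb{N}_2^{\mathbb{N}}$ are called basic sequences. Shift-invariant and weakly mixing refer to the left shift. For $\omega=((p_1,p_2,\ldots),(q_1,q_2,\ldots))$, $\pi_1(\omega)=p_1$ and $\pi_2(\omega)=q_1$. A measure $\nu$ on $\mathbb{N}_2^{\mathbb{N}}$ is positive on $S\subseteq\mathbb{N}$ if $\nu(\{\omega=(\omega_1,\omega_2,\ldots):\omega_1\in S\})>0$. The $P$-Cantor series expansion of $x\in\mathbb{R}$, abbreviated $x=E_0.E_1E_2\cdots$ w.r.t. $P=(p_n)$, is the unique expansion $x=E_0+\sum_{n\ge1}\frac{E_n}{p_1\cdots p_n}$ with $E_0=\lfloor x\rfloor$, $E_n\in\{0,\ldots,p_n-1\}$ for $n\ge 1$, and $E_n\ne p_n-1$ infinitely often. For such $x$ and $Q=(q_n)$, $\psi_{P,Q}(x)=\sum_{n\ge1}\frac{\min(E_n,q_n-1)}{q_1\cdots q_n}$. If $E_n\notin\{0,p_n-1\}$ for all $n\ge1$, put $\rho_P(x)=0$; otherwise $\rho_P(x)=\sup\{k\in\mathbb{N}:\exists n\in\mathbb{N}\text{ such that }E_{n+t}\in\{0,p_{n+t}-1\}\text{ for all integers }t\in[0,k-1]\}$. Put $\mathscr{W}_P^{(k)}=\{x\in\mathbb{R}:\rho_P(x)\le k\}$, $$\mathscr{Z}_{P,Q}^{(k)}=\{x=0.E_1E_2\cdots\text{ w.r.t. }P: E_n<\min(p_n,q_n)\ \forall n\}\cap\mathscr{W}_P^{(k)}\cap(\psi_{P,Q})^{-1}(\mathscr{W}_Q^{(k)}),$$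 and $\phi_{P,Q}^{(k)}=\psi_{P,Q}|_{\mathscr{Z}_{P,Q}^{(k)}}$. A function $f$ on a set $Z\subseteq\mathbb{R}$ is H\"older continuous of exponent $\alpha$ if there is $C$ with $|f(x)-f(y)|\le C|x-y|^\alpha$ for all $x,y\in Z$. *)

theory Defs
  imports "HOL-Probability.Probability"
begin

(* Sequences p_1, p_2, ... are functions on nat with p_(n+1) = P n; likewise for digits. *)

definition basic_sequences :: "(nat \<Rightarrow> nat) set" where
  "basic_sequences = {P. \<forall>n. 2 \<le> P n}"

(* The Borel sigma-algebra of the subspace topology; nat is discrete and nat => nat
   carries the product topology. *)
definition basic_sequence_space :: "(nat \<Rightarrow> nat) measure" where
  "basic_sequence_space = restrict_space borel basic_sequences"

definition left_shift :: "(nat \<Rightarrow> nat) \<Rightarrow> (nat \<Rightarrow> nat)" where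
  "left_shift P = (\<lambda>n. P (Suc n))"

definition shift_invariant :: "(nat \<Rightarrow> nat) measure \<Rightarrow> bool" where
  "shift_invariant M \<longleftrightarrow>
     (\<forall>A\<in>sets M. emeasure M (left_shift -` A \<inter> space M) = emeasure M A)"

definition weakly_mixing :: "(nat \<Rightarrow> nat) measure \<Rightarrow> bool" where
  "weakly_mixing M \<longleftrightarrow>
     (\<forall>A\<in>sets M. \<forall>B\<in>sets M.
        (\<lambda>n. (\<Sum>k<n. \<bar>measure M ((left_shift ^^ k) -` A \<inter> B) - measure M A * measure M B\<bar>) / real n)
          \<longlonglongrightarrow> 0)"

definition positive_on :: "(nat \<Rightarrow> nat) measure \<Rightarrow> nat set \<Rightarrow> bool" where
  "positive_on M S \<longleftrightarrow> emeasure M {P \<in> space M. P 0 \<in> S} > 0"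

definition pi1 :: "(nat \<Rightarrow> nat) \<times> (nat \<Rightarrow> nat) \<Rightarrow> nat" where
  "pi1 \<omega> = fst \<omega> 0"

definition pi2 :: "(nat \<Rightarrow> nat) \<times> (nat \<Rightarrow> nat) \<Rightarrow> nat" where
  "pi2 \<omega> = snd \<omega> 0"

definition is_cantor_expansion :: "(nat \<Rightarrow> nat) \<Rightarrow> real \<Rightarrow> (nat \<Rightarrow> nat) \<Rightarrow> bool" where
  "is_cantor_expansion P x E \<longleftrightarrow>
     (\<forall>n. E n \<in> {0..P n - 1}) \<and>
     (\<exists>\<^sub>\<infinity>n. E n \<noteq> P n - 1) \<and>
     x = of_int \<lfloor>x\<rfloor> + (\<Sum>n. real (E n) / (\<Prod>j\<le>n. real (P j)))"

(* The digits after the point; the integer part E_0 is always \<lfloor>x\<rfloor>. *)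
definition cantor_digits :: "(nat \<Rightarrow> nat) \<Rightarrow> real \<Rightarrow> nat \<Rightarrow> nat" where
  "cantor_digits P x = (THE E. is_cantor_expansion P x E)"

definition psi :: "(nat \<Rightarrow> nat) \<Rightarrow> (nat \<Rightarrow> nat) \<Rightarrow> real \<Rightarrow> real" where
  "psi P Q x = (\<Sum>n. real (min (cantor_digits P x n) (Q n - 1)) / (\<Prod>j\<le>n. real (Q j)))"

definition rho :: "(nat \<Rightarrow> nat) \<Rightarrow> real \<Rightarrow> enat" where
  "rho P x =
     (if \<forall>n. cantor_digits P x n \<notin> {0, P n - 1} then 0
      else Sup {enat k | k. 1 \<le> k \<and> (\<exists>n. \<forall>t<k. cantor_digits P x (n + t) \<in> {0, P (n + t) - 1})})"

definition W_set :: "(nat \<Rightarrow> nat) \<Rightarrow> nat \<Rightarrow> real set" where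
  "W_set P k = {x. rho P x \<le> enat k}"

definition Z_set :: "(nat \<Rightarrow> nat) \<Rightarrow> (nat \<Rightarrow> nat) \<Rightarrow> nat \<Rightarrow> real set" where
  "Z_set P Q k =
     {x. \<lfloor>x\<rfloor> = 0 \<and> (\<forall>n. cantor_digits P x n < min (P n) (Q n))} \<inter> W_set P k \<inter> psi P Q -` W_set Q k"

definition phi :: "(nat \<Rightarrow> nat) \<Rightarrow> (nat \<Rightarrow> nat) \<Rightarrow> nat \<Rightarrow> real \<Rightarrow> real" where
  "phi P Q k = restrict (psi P Q) (Z_set P Q k)"

definition hoelder_on :: "real \<Rightarrow> real set \<Rightarrow> (real \<Rightarrow> real) \<Rightarrow> bool" where
  "hoelder_on \<alpha> Z f \<longleftrightarrow> (\<exists>C. \<forall>x\<in>Z. \<forall>y\<in>Z. \<bar>f x - f y\<bar> \<le> C * \<bar>x - y\<bar> powr \<alpha>)"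

end

theory Submission
  imports Defs
begin

text \<open>
  If \<open>x < y\<close> lie in the set \<open>Z\<close> and their \<open>P\<close>-digits first differ at index \<open>n\<close>, then some digit of \<open>x\<close>
  among the next \<open>k + 1\<close> is not maximal, so \<open>y - x \<ge> 1 / (p\<^sub>0 \<cdots> p\<^sub>n\<^sub>+\<^sub>k\<^sub>+\<^sub>1)\<close>; on the other hand
  the images differ by at most \<open>1 / (q\<^sub>0 \<cdots> q\<^sub>n\<^sub>-\<^sub>1)\<close>. Hence exponent \<open>\<alpha>\<close> is admissible as soon as
  \<open>\<alpha> (log p\<^sub>0 + \<cdots> + log p\<^sub>n\<^sub>+\<^sub>k\<^sub>+\<^sub>1) - (log q\<^sub>0 + \<cdots> + log q\<^sub>n\<^sub>-\<^sub>1)\<close> is bounded above in \<open>n\<close>.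

  For this, only half of Birkhoff's theorem is needed, and for each factor separately: if \<open>f\<close> has negative
  integral over an ergodic system, its Birkhoff sums are almost surely bounded above. Otherwise they are
  almost surely unbounded, by ergodicity, and the maximal ergodic inequality yields \<open>\<integral> f \<ge> 0\<close>.
  Apply this to \<open>log p\<^sub>0 - c\<close> and \<open>d - log q\<^sub>0\<close>, where \<open>c\<close> and \<open>d\<close> are close to the two integrals
  and satisfy \<open>\<alpha> c = d\<close>.
\<close>

section \<open>A one-sided ergodic theorem\<close>

definition birkhoff_sum :: "('a \<Rightarrow> 'a) \<Rightarrow> ('a \<Rightarrow> real) \<Rightarrow> nat \<Rightarrow> 'a \<Rightarrow> real" where
  "birkhoff_sum T f n x = (\<Sum>k<n. f ((T ^^ k) x))"

lemma birkhoff_sum_Suc: "birkhoff_sum T f (Suc n) x = f x + birkhoff_sum T f n (T x)"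
  unfolding birkhoff_sum_def
  by (subst sum.lessThan_Suc_shift) (simp add: funpow_swap1 del: sum.lessThan_Suc)

text \<open>The running maximum of the Birkhoff sums of lengths \<open>0, \<dots>, n\<close>, written as a recursion
  because this is the form in which it enters Garsia's argument.\<close>

primrec birkhoff_max :: "('a \<Rightarrow> 'a) \<Rightarrow> ('a \<Rightarrow> real) \<Rightarrow> nat \<Rightarrow> 'a \<Rightarrow> real" where
  "birkhoff_max T f 0 = (\<lambda>x. 0)"
| "birkhoff_max T f (Suc n) = (\<lambda>x. max 0 (f x + birkhoff_max T f n (T x)))"

lemma birkhoff_max_nonneg: "0 \<le> birkhoff_max T f n x"
  by (cases n) auto

lemma birkhoff_max_Suc_ge: "birkhoff_max T f n x \<le> birkhoff_max T f (Suc n) x"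
proof (induction n arbitrary: x)
  case (Suc n)
  show ?case using Suc[of "T x"] by auto
qed auto

lemma birkhoff_max_mono: "m \<le> n \<Longrightarrow> birkhoff_max T f m x \<le> birkhoff_max T f n x"
  by (rule lift_Suc_mono_le[of "\<lambda>n. birkhoff_max T f n x"]) (rule birkhoff_max_Suc_ge)

lemma birkhoff_sum_le_max: "birkhoff_sum T f n x \<le> birkhoff_max T f n x"
proof (induction n arbitrary: x)
  case (Suc n)
  show ?case using Suc[of "T x"] by (auto simp: birkhoff_sum_Suc max_def)
qed (simp add: birkhoff_sum_def)

lemma integral_preserving:
  fixes f :: "'a \<Rightarrow> real"
  assumes T: "T \<in> measurable M M" and inv: "distr M M T = M" and f: "integrable M f"
  shows "integrable M (\<lambda>x. f (T x))" and "(\<integral>x. f (T x) \<partial>M) = (\<integral>x. f x \<partial>M)"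
proof -
  have "integrable (distr M M T) f" using inv f by simp
  then show "integrable M (\<lambda>x. f (T x))" using T f by (subst (asm) integrable_distr_eq) auto
  have "integral\<^sup>L (distr M M T) f = (\<integral>x. f (T x) \<partial>M)"
    by (rule integral_distr) (use T f in auto)
  then show "(\<integral>x. f (T x) \<partial>M) = (\<integral>x. f x \<partial>M)" using inv by simp
qed

lemma integrable_birkhoff_max:
  assumes "T \<in> measurable M M" and "distr M M T = M" and "integrable M f"
  shows "integrable M (birkhoff_max T f n)"
proof (induction n)
  case (Suc n)
  have "integrable M (\<lambda>x. f x + birkhoff_max T f n (T x))"
    using integral_preserving(1)[OF assms(1,2) Suc] assms(3) by simp
  then show ?case by simp
qed simp

text \<open>Garsia's argument. Where \<open>birkhoff_max T f (Suc m) x\<close> is positive it equals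
  \<open>f x + birkhoff_max T f m (T x)\<close>; elsewhere it is 0, while
  \<open>birkhoff_max T f m (T x)\<close> is nonnegative. So
  \<open>birkhoff_max T f (Suc m) x - birkhoff_max T f m (T x)\<close> is pointwise at most the
  integrand, and by invariance and monotonicity of the running maximum its integral is
  nonnegative.\<close>

lemma maximal_ergodic_inequality:
  assumes T: "T \<in> measurable M M" and inv: "distr M M T = M" and f: "integrable M f"
  shows "0 \<le> (\<integral>x. indicator {x \<in> space M. 0 < birkhoff_max T f n x} x * f x \<partial>M)"
proof (cases n)
  case (Suc m)
  let ?G = "birkhoff_max T f"
  note int = integrable_birkhoff_max[OF assms]
  have meas: "{x \<in> space M. 0 < ?G n x} \<in> sets M"
    using int[of n, THEN borel_measurable_integrable] by measurable
  have "0 \<le> (\<integral>x. ?G (Suc m) x \<partial>M) - (\<integral>x. ?G m x \<partial>M)"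
    using integral_mono[OF int int birkhoff_max_Suc_ge] by simp
  also have "\<dots> = (\<integral>x. ?G (Suc m) x - ?G m (T x) \<partial>M)"
    using integral_preserving[OF T inv int[of m]] int[of "Suc m"]
    by (subst Bochner_Integration.integral_diff) auto
  also have "\<dots> \<le> (\<integral>x. indicator {x \<in> space M. 0 < ?G n x} x * f x \<partial>M)"
  proof (rule integral_mono)
    show "integrable M (\<lambda>x. ?G (Suc m) x - ?G m (T x))"
      using int[of "Suc m"] integral_preserving(1)[OF T inv int[of m]]
      by (rule Bochner_Integration.integrable_diff)
    show "integrable M (\<lambda>x. indicator {x \<in> space M. 0 < ?G n x} x * f x)"
      using integrable_mult_indicator[OF meas f] by simp
    show "?G (Suc m) x - ?G m (T x) \<le> indicator {x \<in> space M. 0 < ?G n x} x * f x"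
      if "x \<in> space M" for x
      using that birkhoff_max_nonneg[of T f m "T x"] by (auto simp: Suc indicator_def max_def)
  qed
  finally show ?thesis .
qed simp

theorem (in prob_space) AE_bdd_above_birkhoff_sum:
  assumes T: "T \<in> measurable M M" and inv: "distr M M T = M"
    and ergodic: "\<And>A. A \<in> sets M \<Longrightarrow> T -` A \<inter> space M = A \<Longrightarrow> prob A = 0 \<or> prob A = 1"
    and f: "integrable M f" and neg: "(\<integral>x. f x \<partial>M) < 0"
  shows "AE x in M. bdd_above (range (\<lambda>n. birkhoff_sum T f n x))"
proof -
  let ?S = "birkhoff_sum T f" and ?G = "birkhoff_max T f"
  define A where "A = {x \<in> space M. \<not> bdd_above (range (\<lambda>n. ?S n x))}"
  \<comment> \<open>Natural numbers suffice as bounds, which makes \<open>A\<close> a countable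
    combination of measurable events.\<close>
  have bdd_iff: "bdd_above (range (\<lambda>n. ?S n x)) \<longleftrightarrow> (\<exists>K::nat. \<forall>n. ?S n x \<le> real K)" for x
    unfolding bdd_above_def by (auto intro: order_trans real_arch_simple) (meson order_trans real_arch_simple)
  have fm: "f \<in> borel_measurable M" using f by auto
  have Tk: "T ^^ k \<in> measurable M M" for k
    using T by (induction k) (auto simp: id_def intro: measurable_comp[unfolded comp_def] simp: o_def)
  have [measurable]: "?S n \<in> borel_measurable M" for n
    unfolding birkhoff_sum_def using measurable_compose[OF Tk fm] by (intro borel_measurable_sum)
  have A: "A \<in> sets M"
    unfolding A_def bdd_iff by measurable
  have Tx: "T x \<in> space M" if "x \<in> space M" for x
    using T that by (rule measurable_space)
  \<comment> \<open>Invariance of \<open>A\<close>: by \<open>birkhoff_sum_Suc\<close> the sums at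
    \<open>x\<close> and at \<open>T x\<close> differ by the constant \<open>f x\<close>, up to a
    shift of the index.\<close>
  have "bdd_above (range (\<lambda>n. ?S n (T x))) \<longleftrightarrow> bdd_above (range (\<lambda>n. ?S n x))" for x
  proof
    assume "bdd_above (range (\<lambda>n. ?S n (T x)))"
    then obtain K where K: "\<And>n. ?S n (T x) \<le> K" by (auto simp: bdd_above_def)
    \<comment> \<open>The 0 in the maximum covers the empty sum \<open>n = 0\<close>, which the
      recursion does not reach.\<close>
    have "?S n x \<le> max 0 (f x + K)" for n
      using add_left_mono[OF K, of "f x"]
      by (cases n) (auto simp: birkhoff_sum_Suc birkhoff_sum_def[of _ _ 0] le_max_iff_disj)
    then show "bdd_above (range (\<lambda>n. ?S n x))" by (auto simp: bdd_above_def)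
  next
    assume "bdd_above (range (\<lambda>n. ?S n x))"
    then obtain K where "\<And>n. ?S n x \<le> K" by (auto simp: bdd_above_def)
    then have "?S n (T x) \<le> K - f x" for n
      using birkhoff_sum_Suc[of T f n x] by (metis le_diff_eq add.commute)
    then show "bdd_above (range (\<lambda>n. ?S n (T x)))" by (auto simp: bdd_above_def)
  qed
  then have "T -` A \<inter> space M = A" unfolding A_def using Tx by auto
  with ergodic A have "prob A = 0 \<or> prob A = 1" by blast
  moreover have "prob A \<noteq> 1"
  proof
    assume "prob A = 1"
    then have AE: "AE x in M. x \<in> A" using A by (simp add: prob_eq_1)
    let ?I = "\<lambda>n. {x \<in> space M. 0 < ?G n x}"
    \<comment> \<open>At a point of \<open>A\<close> some Birkhoff sum is positive. The running
      maxima dominate the sums and increase, so almost every point lies in \<open>?I n\<close> from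
      some \<open>n\<close> on, and the integrals of the maximal inequality tend to the full
      integral of \<open>f\<close>.\<close>
    have "(\<lambda>n. \<integral>x. indicator (?I n) x * f x \<partial>M) \<longlonglongrightarrow> (\<integral>x. f x \<partial>M)"
    proof (rule integral_dominated_convergence)
      show "integrable M (\<lambda>x. \<bar>f x\<bar>)" using f by simp
      show "AE x in M. (\<lambda>n. indicator (?I n) x * f x) \<longlonglongrightarrow> f x"
        using AE
      proof eventually_elim
        case (elim x)
        then obtain n where n: "0 < ?S n x" and x: "x \<in> space M"
          unfolding A_def bdd_above_def by (auto simp: not_le)
        have "indicator (?I m) x * f x = f x" if "n \<le> m" for m
          using n x birkhoff_sum_le_max[of T f n x] birkhoff_max_mono[OF that, of T f x] by auto
        then show ?case by (intro tendsto_eventually eventually_sequentiallyI)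
      qed
      show "(\<lambda>x. indicator (?I n) x * f x) \<in> borel_measurable M" for n
        using integrable_birkhoff_max[OF T inv f, of n, THEN borel_measurable_integrable] fm
        by measurable
    qed (use fm in \<open>auto simp: indicator_def\<close>)
    then have "0 \<le> (\<integral>x. f x \<partial>M)"
      by (rule LIMSEQ_le_const) (use maximal_ergodic_inequality[OF T inv f] in auto)
    with neg show False by simp
  qed
  ultimately have "prob A = 0" by blast
  then have "AE x in M. x \<notin> A" using A by (simp add: prob_eq_0)
  then show ?thesis unfolding A_def by auto
qed

section \<open>Cantor series\<close>

definition base_prod :: "(nat \<Rightarrow> nat) \<Rightarrow> nat \<Rightarrow> real" where
  "base_prod P n = (\<Prod>j<n. real (P j))"

text \<open>Omits the integer part, so that the same estimates serve a point of the unit interval in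
  base \<open>P\<close> and its image in base \<open>Q\<close>.\<close>

definition cantor_value :: "(nat \<Rightarrow> nat) \<Rightarrow> (nat \<Rightarrow> nat) \<Rightarrow> real" where
  "cantor_value P E = (\<Sum>n. real (E n) / (\<Prod>j\<le>n. real (P j)))"

lemma base_prod_0 [simp]: "base_prod P 0 = 1"
  and base_prod_Suc: "base_prod P (Suc n) = base_prod P n * real (P n)"
  by (simp_all add: base_prod_def)

lemma cantor_value_eq: "cantor_value P E = (\<Sum>n. real (E n) / base_prod P (Suc n))"
  by (simp add: cantor_value_def base_prod_def lessThan_Suc_atMost)

context
  fixes P :: "nat \<Rightarrow> nat"
  assumes P: "P \<in> basic_sequences"
begin

lemma base_ge_2: "2 \<le> P n"
  using P by (simp add: basic_sequences_def)

lemma base_prod_pos: "0 < base_prod P n"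
  unfolding base_prod_def using base_ge_2 by (intro prod_pos) (auto intro: less_le_trans[of 0 2])

lemma base_prod_mono: "m \<le> n \<Longrightarrow> base_prod P m \<le> base_prod P n"
proof (rule lift_Suc_mono_le[of "base_prod P"])
  show "base_prod P n \<le> base_prod P (Suc n)" for n
    using base_prod_pos[of n] base_ge_2[of n] by (simp add: base_prod_Suc)
qed

lemma base_prod_ge_power: "2 ^ n \<le> base_prod P n"
proof (induction n)
  case (Suc n)
  have "2 ^ n * 2 \<le> base_prod P n * real (P n)"
    using Suc base_ge_2[of n] base_prod_pos[of n] by (intro mult_mono) auto
  then show ?case by (simp add: base_prod_Suc mult.commute)
qed simp

lemma inverse_base_prod_tendsto_0: "(\<lambda>n. 1 / base_prod P n) \<longlonglongrightarrow> 0"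
proof (rule tendsto_sandwich[of "\<lambda>_. 0" _ _ "\<lambda>n. (1 / 2) ^ n"])
  show "(\<lambda>n. (1 / 2 :: real) ^ n) \<longlonglongrightarrow> 0" by (rule LIMSEQ_realpow_zero) auto
  show "\<forall>\<^sub>F n in sequentially. 1 / base_prod P n \<le> (1 / 2) ^ n"
    using base_prod_ge_power by (auto simp: power_divide intro!: always_eventually frac_le)
  show "\<forall>\<^sub>F n in sequentially. 0 \<le> 1 / base_prod P n"
    using base_prod_pos by (auto intro!: always_eventually less_imp_le)
qed auto

lemma max_digit_term:
  "real (P n - 1) / base_prod P (Suc n) = 1 / base_prod P n - 1 / base_prod P (Suc n)"
  using base_ge_2[of n] base_prod_pos[of n] by (simp add: base_prod_Suc of_nat_diff field_simps)

text \<open>By \<open>max_digit_term\<close> the series telescopes, as in 0.0999... = 0.1. Padding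
  with zeros below \<open>n\<close> allows termwise comparison with whole Cantor series.\<close>

lemma max_digit_tail_sums:
  "(\<lambda>m. if m < n then 0 else real (P m - 1) / base_prod P (Suc m)) sums (1 / base_prod P n)"
proof -
  have "(\<lambda>m. 1 / base_prod P (m + n)) \<longlonglongrightarrow> 0"
    by (rule LIMSEQ_ignore_initial_segment[OF inverse_base_prod_tendsto_0])
  from telescope_sums'[OF this]
  have "(\<lambda>m. real (P (m + n) - 1) / base_prod P (Suc (m + n))) sums (1 / base_prod P n)"
    by (simp add: max_digit_term[simplified])
  then show ?thesis
    using sums_iff_shift[of "\<lambda>m. if m < n then 0 else real (P m - 1) / base_prod P (Suc m)" n]
    by simp
qed

lemma cantor_sums:
  assumes "\<And>n. E n \<le> P n - 1"
  shows "(\<lambda>n. real (E n) / base_prod P (Suc n)) sums cantor_value P E"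
  unfolding cantor_value_eq
proof (rule summable_sums[OF summable_comparison_test'])
  show "summable (\<lambda>n. real (P n - 1) / base_prod P (Suc n))"
    using max_digit_tail_sums[of 0] by (simp add: sums_iff)
  show "norm (real (E n) / base_prod P (Suc n)) \<le> real (P n - 1) / base_prod P (Suc n)" for n
    using assms[of n] base_prod_pos[of "Suc n"]
    by (auto simp: abs_of_pos intro!: divide_right_mono)
qed

text \<open>Common digits cancel and every later digit difference is at most the maximal digit, so
  the maximal tail dominates.\<close>

lemma cantor_value_diff_le:
  assumes E: "\<And>n. E n \<le> P n - 1" and F: "\<And>n. F n \<le> P n - 1" and eq: "\<And>m. m < n \<Longrightarrow> E m = F m"
  shows "cantor_value P F - cantor_value P E \<le> 1 / base_prod P n"
proof (rule sums_le[OF _ sums_diff[OF cantor_sums[OF F] cantor_sums[OF E]] max_digit_tail_sums])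
  fix m
  have "real (F m) - real (E m) \<le> real (P m - 1)" using F[of m] by linarith
  then show "real (F m) / base_prod P (Suc m) - real (E m) / base_prod P (Suc m)
      \<le> (if m < n then 0 else real (P m - 1) / base_prod P (Suc m))"
    using eq[of m] base_prod_pos[of "Suc m"]
    by (auto simp: diff_divide_distrib[symmetric] intro!: divide_right_mono)
qed

text \<open>In the worst case the unit gained at place \<open>n\<close> is exactly cancelled by a
  maximal tail of \<open>E\<close> against zeros of \<open>F\<close>. A non-maximal digit of
  \<open>E\<close> at \<open>t\<close> spoils this cancellation and leaves at least one unit of
  place \<open>t\<close>.\<close>

lemma cantor_value_gap:
  assumes E: "\<And>n. E n \<le> P n - 1" and F: "\<And>n. F n \<le> P n - 1" and eq: "\<And>m. m < n \<Longrightarrow> E m = F m"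
    and less: "E n < F n" and "n < t" and nmax: "E t \<noteq> P t - 1"
  shows "1 / base_prod P (Suc t) \<le> cantor_value P F - cantor_value P E"
proof -
  \<comment> \<open>The least possible digit difference at each place: \<open>1\<close> at \<open>n\<close>, and after that \<open>1 - P m\<close>, increased by one at \<open>t\<close>.\<close>
  let ?g = "\<lambda>m. (if m = n then 1 / base_prod P (Suc m) else 0)
     - (if m < Suc n then 0 else real (P m - 1) / base_prod P (Suc m))
     + (if m = t then 1 / base_prod P (Suc m) else 0)"
  have g: "?g sums (1 / base_prod P (Suc n) - 1 / base_prod P (Suc n) + 1 / base_prod P (Suc t))"
    by (intro sums_add sums_diff max_digit_tail_sums
        sums_single[of n "\<lambda>m. 1 / base_prod P (Suc m)"] sums_single[of t "\<lambda>m. 1 / base_prod P (Suc m)"])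
  have "1 / base_prod P (Suc n) - 1 / base_prod P (Suc n) + 1 / base_prod P (Suc t)
      \<le> cantor_value P F - cantor_value P E"
  proof (rule sums_le[OF _ g sums_diff[OF cantor_sums[OF F] cantor_sums[OF E]]])
    fix m
    let ?b = "base_prod P (Suc m)"
    have b: "0 < ?b" by (rule base_prod_pos)
    have "?g m = ((if m = n then 1 else 0) - (if m < Suc n then 0 else real (P m - 1))
        + (if m = t then 1 else 0)) / ?b"
      by (simp add: diff_divide_distrib add_divide_distrib)
    also have "\<dots> \<le> (real (F m) - real (E m)) / ?b"
    proof (rule divide_right_mono)
      consider "m < n" | "m = n" | "m = t" | "n < m" "m \<noteq> t" using \<open>n < t\<close> by linarith
      then show "(if m = n then 1 else 0) - (if m < Suc n then 0 else real (P m - 1))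
        + (if m = t then 1 else 0) \<le> real (F m) - real (E m)"
      proof cases
        case 3
        have "E t + 1 \<le> P t - 1" using E[of t] nmax by linarith
        then have "real (E t) + 1 \<le> real (P t - 1)" by linarith
        then show ?thesis using 3 \<open>n < t\<close> by simp
      next
        case 4
        then show ?thesis using E[of m] by simp
      qed (use eq less \<open>n < t\<close> in auto)
    qed (use b in simp)
    finally show "?g m \<le> real (F m) / ?b - real (E m) / ?b" by (simp add: diff_divide_distrib)
  qed
  then show ?thesis by simp
qed

section \<open>Uniqueness and existence of Cantor expansions\<close>

lemma cantor_value_inj:
  assumes E: "\<And>n. E n \<le> P n - 1" "\<exists>\<^sub>\<infinity>n. E n \<noteq> P n - 1"
    and F: "\<And>n. F n \<le> P n - 1" "\<exists>\<^sub>\<infinity>n. F n \<noteq> P n - 1"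
    and eq: "cantor_value P E = cantor_value P F"
  shows "E = F"
proof (rule ccontr)
  have neq: False
    if h: "cantor_value P E = cantor_value P F" "\<And>n. E n \<le> P n - 1" "\<exists>\<^sub>\<infinity>n. E n \<noteq> P n - 1"
      "\<And>n. F n \<le> P n - 1" "\<And>m. m < n \<Longrightarrow> E m = F m" "E n < F n" for E F n
  proof -
    \<comment> \<open>Infinitely many non-maximal digits provide one beyond the first difference
      \<open>n\<close>, and the resulting positive gap contradicts equal values.\<close>
    obtain t where "n < t" "E t \<noteq> P t - 1" using h(3) unfolding INFM_nat by blast
    with cantor_value_gap[OF h(2,4,5,6)] base_prod_pos[of "Suc t"] h(1) show False
      by (simp add: zero_less_divide_iff not_le[symmetric])
  qed
  assume "E \<noteq> F"
  then have "\<exists>n. E n \<noteq> F n" by auto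
  from exists_least_iff[THEN iffD1, OF this]
  obtain n where n: "E n \<noteq> F n" "\<And>m. m < n \<Longrightarrow> E m = F m" by blast
  then consider "E n < F n" | "F n < E n" by linarith
  then show False
    using neq[of E F n] neq[of F E n] E F eq n(2) by cases (metis)+
qed

text \<open>Greedy expansion: \<open>d n / base_prod P n\<close> is the largest multiple of
  \<open>1 / base_prod P n\<close> not exceeding the fractional part \<open>y\<close>, and the
  digits measure the increments between successive truncations.\<close>

lemma cantor_expansion_exists: "\<exists>E. is_cantor_expansion P x E"
proof -
  define y where "y = x - of_int \<lfloor>x\<rfloor>"
  have y: "0 \<le> y" "y < 1" unfolding y_def by linarith+
  define d where "d n = \<lfloor>y * base_prod P n\<rfloor>" for n
  \<comment> \<open>\<open>nat\<close> truncates nothing here: \<open>ge\<close> shows that its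
    argument is nonnegative.\<close>
  define E where "E n = nat (d (Suc n) - int (P n) * d n)" for n
  have d_le: "real_of_int (d n) \<le> y * base_prod P n" and d_gt: "y * base_prod P n < real_of_int (d n) + 1" for n
    unfolding d_def by linarith+
  have ge: "int (P n) * d n \<le> d (Suc n)" for n
  proof -
    have "real_of_int (int (P n) * d n) \<le> y * base_prod P (Suc n)"
      using mult_left_mono[OF d_le[of n], of "real (P n)"] by (simp add: base_prod_Suc ac_simps)
    then show ?thesis unfolding d_def[of "Suc n"] le_floor_iff .
  qed
  have lt: "d (Suc n) < int (P n) * d n + int (P n)" for n
  proof -
    have "y * base_prod P (Suc n) < real (P n) * (real_of_int (d n) + 1)"
      using mult_strict_left_mono[OF d_gt[of n], of "real (P n)"] base_ge_2[of n]
      by (simp add: base_prod_Suc ac_simps)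
    then have "real_of_int (d (Suc n)) < real (P n) * (real_of_int (d n) + 1)"
      using d_le[of "Suc n"] by linarith
    also have "\<dots> = real_of_int (int (P n) * d n + int (P n))" by (simp add: algebra_simps)
    finally show ?thesis by linarith
  qed
  have E_int: "int (E n) = d (Suc n) - int (P n) * d n" for n
    using ge[of n] by (simp add: E_def)
  have E_le: "E n \<le> P n - 1" for n
    using E_int[of n] lt[of n] base_ge_2[of n] by linarith
  have d0: "d 0 = 0" unfolding d_def using y by (simp add: floor_eq_iff)
  \<comment> \<open>The partial sums are the greedy truncations, which lie within
    \<open>1 / base_prod P n\<close> of \<open>y\<close>.\<close>
  have partial: "(\<Sum>m<n. real (E m) / base_prod P (Suc m)) = real_of_int (d n) / base_prod P n" for n
  proof (induction n)
    case (Suc n)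
    have "real (E n) = real_of_int (d (Suc n)) - real (P n) * real_of_int (d n)"
      using E_int[of n] by (metis of_int_diff of_int_mult of_int_of_nat_eq)
    then show ?case
      using Suc base_prod_pos[of n] base_ge_2[of n] by (simp add: base_prod_Suc field_simps)
  qed (simp add: d0)
  have "(\<lambda>n. real_of_int (d n) / base_prod P n) \<longlonglongrightarrow> y"
  proof (rule tendsto_sandwich)
    show "(\<lambda>n. y - 1 / base_prod P n) \<longlonglongrightarrow> y"
      using tendsto_diff[OF tendsto_const inverse_base_prod_tendsto_0, of y] by simp
    show "\<forall>\<^sub>F n in sequentially. y - 1 / base_prod P n \<le> real_of_int (d n) / base_prod P n"
    proof (rule always_eventually, rule allI)
      fix n
      show "y - 1 / base_prod P n \<le> real_of_int (d n) / base_prod P n"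
        using divide_right_mono[OF less_imp_le[OF d_gt[of n]], of "base_prod P n"] base_prod_pos[of n]
        by (simp add: add_divide_distrib)
    qed
    show "\<forall>\<^sub>F n in sequentially. real_of_int (d n) / base_prod P n \<le> y"
      using d_le base_prod_pos by (auto simp: field_simps)
  qed auto
  then have "(\<lambda>n. real (E n) / base_prod P (Suc n)) sums y"
    unfolding sums_def partial .
  then have val: "cantor_value P E = y" by (simp add: cantor_value_eq sums_iff)
  have "\<exists>\<^sub>\<infinity>n. E n \<noteq> P n - 1"
  proof (rule ccontr)
    assume "\<not> (\<exists>\<^sub>\<infinity>n. E n \<noteq> P n - 1)"
    \<comment> \<open>A maximal tail from \<open>N\<close> on sums to
      \<open>1 / base_prod P N\<close>. Then \<open>y * base_prod P N\<close> would equal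
      \<open>d N + 1\<close>, although \<open>d N\<close> is its floor.\<close>
    then obtain N where N: "\<And>n. N \<le> n \<Longrightarrow> E n = P n - 1"
      by (auto simp: not_INFM MOST_nat_le)
    let ?h = "\<lambda>n. real (E n) / base_prod P (Suc n)"
    have "(\<lambda>m. (if m < N then ?h m else 0) + (if m < N then 0 else real (P m - 1) / base_prod P (Suc m)))
        sums ((\<Sum>m<N. ?h m) + 1 / base_prod P N)"
      using sums_If_finite_set[of "{..<N}" ?h] max_digit_tail_sums[of N]
      by (intro sums_add) auto
    moreover have "(\<lambda>m. (if m < N then ?h m else 0) + (if m < N then 0 else real (P m - 1) / base_prod P (Suc m))) = ?h"
      using N by auto
    ultimately have "?h sums ((\<Sum>m<N. ?h m) + 1 / base_prod P N)" by metis
    then have "y = real_of_int (d N) / base_prod P N + 1 / base_prod P N"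
      using val by (simp add: cantor_value_eq sums_iff partial)
    then show False using d_gt[of N] base_prod_pos[of N] by (simp add: field_simps)
  qed
  with E_le val have "is_cantor_expansion P x E"
    unfolding is_cantor_expansion_def cantor_value_def[symmetric] by (auto simp: y_def)
  then show ?thesis by blast
qed

lemma cantor_digits: "is_cantor_expansion P x (cantor_digits P x)"
  unfolding cantor_digits_def
proof (rule theI'[of "is_cantor_expansion P x"])
  have "E = F" if "is_cantor_expansion P x E" "is_cantor_expansion P x F" for E F
  proof (rule cantor_value_inj)
    have "x = of_int \<lfloor>x\<rfloor> + cantor_value P E" "x = of_int \<lfloor>x\<rfloor> + cantor_value P F"
      using that by (simp_all add: is_cantor_expansion_def cantor_value_def)
    then show "cantor_value P E = cantor_value P F" by linarith
  qed (use that in \<open>simp_all add: is_cantor_expansion_def\<close>)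
  with cantor_expansion_exists[of x] show "\<exists>!E. is_cantor_expansion P x E" by blast
qed

lemma cantor_digits_le: "cantor_digits P x n \<le> P n - 1"
  using cantor_digits[of x] by (simp add: is_cantor_expansion_def)

lemma cantor_value_digits: "\<lfloor>x\<rfloor> = 0 \<Longrightarrow> cantor_value P (cantor_digits P x) = x"
  using cantor_digits[of x] by (simp add: is_cantor_expansion_def cantor_value_def)

end

section \<open>Hoelder bounds from the growth of the base products\<close>

lemma W_set_nonextreme_digit:
  assumes "x \<in> W_set P k"
  shows "\<exists>t\<le>k. cantor_digits P x (n + t) \<notin> {0, P (n + t) - 1}"
proof (rule ccontr)
  assume *: "\<not> ?thesis"
  \<comment> \<open>The digit at offset 0 is extreme, so \<open>rho P x\<close> is the supremum and
    not the default value 0.\<close>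
  then have "cantor_digits P x n \<in> {0, P n - 1}" by (metis add_0_right le0)
  then have "rho P x = Sup {enat k | k. 1 \<le> k \<and> (\<exists>n. \<forall>t<k. cantor_digits P x (n + t) \<in> {0, P (n + t) - 1})}"
    unfolding rho_def by metis
  \<comment> \<open>The offsets up to \<open>k\<close> form a run of length \<open>Suc k\<close>,
    one more than \<open>W_set\<close> permits.\<close>
  also have "enat (Suc k) \<le> \<dots>"
    by (rule Sup_upper) (use * in \<open>auto simp: less_Suc_eq_le\<close>)
  finally show False using assms by (auto simp: W_set_def dest: order_trans)
qed

text \<open>For digits first differing at \<open>n\<close>, the hypothesis on \<open>K\<close>
  compares the upper bound \<open>1 / base_prod Q n\<close> for the distance of the images with the
  power of the lower bound \<open>1 / base_prod P (n + k + 2)\<close> for the distance of the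
  points.\<close>

lemma psi_hoelder_bound:
  assumes P: "P \<in> basic_sequences" and Q: "Q \<in> basic_sequences" and \<alpha>: "0 < \<alpha>"
    and K: "\<And>n. base_prod P (n + k + 2) powr \<alpha> \<le> K * base_prod Q n"
    and x: "x \<in> Z_set P Q k" and y: "y \<in> Z_set P Q k"
  shows "\<bar>psi P Q x - psi P Q y\<bar> \<le> K * \<bar>x - y\<bar> powr \<alpha>"
proof -
  let ?D = "cantor_digits P"
  have Q_digit: "?D z n \<le> Q n - 1" if "z \<in> Z_set P Q k" for z n
    using that by (auto simp: Z_set_def less_eq_Suc_le dest!: spec[of _ n])
  \<comment> \<open>On \<open>Z_set\<close> the digits also stay below the bases in
    \<open>Q\<close>, so the \<open>min\<close> in \<open>psi\<close> is inert and the same digits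
    are read in base \<open>Q\<close>.\<close>
  have psi: "psi P Q z = cantor_value Q (?D z)" if "z \<in> Z_set P Q k" for z
    unfolding psi_def cantor_value_def using Q_digit[OF that] by (simp add: min_absorb1)
  have val: "cantor_value P (?D z) = z" if "z \<in> Z_set P Q k" for z
    using that cantor_value_digits[OF P] by (simp add: Z_set_def)
  have main: "\<bar>psi P Q x - psi P Q y\<bar> \<le> K * \<bar>x - y\<bar> powr \<alpha>"
    if x: "x \<in> Z_set P Q k" and y: "y \<in> Z_set P Q k"
      and eq: "\<And>m. m < n \<Longrightarrow> ?D x m = ?D y m" and less: "?D x n < ?D y n" for x y n
  proof -
    have eq': "?D y m = ?D x m" if "m < n" for m using eq[OF that] by simp
    have "x \<in> W_set P k" using x by (simp add: Z_set_def)
    \<comment> \<open>The window starts just after \<open>n\<close>, since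
      \<open>cantor_value_gap\<close> needs a place beyond the first difference. The place found is
      at most \<open>n + k + 1\<close>; the product through that place has index at most
      \<open>n + k + 2\<close>.\<close>
    from W_set_nonextreme_digit[OF this, of "Suc n"] obtain t where
      t: "t \<le> k" "?D x (Suc n + t) \<noteq> P (Suc n + t) - 1" by blast
    have "1 / base_prod P (n + k + 2) \<le> 1 / base_prod P (Suc (Suc n + t))"
      using t(1) base_prod_pos[OF P] by (intro divide_left_mono base_prod_mono[OF P] mult_pos_pos) auto
    also have "\<dots> \<le> y - x"
      using cantor_value_gap[OF P cantor_digits_le[OF P] cantor_digits_le[OF P] eq less _ t(2)]
      by (simp add: val x y)
    finally have gap: "1 / base_prod P (n + k + 2) \<le> y - x" .
    have pos: "0 < 1 / base_prod P (n + k + 2)" using base_prod_pos[OF P] by simp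
    have "0 < K * base_prod Q n" using K[of n] base_prod_pos[OF P, of "n + k + 2"]
      by (metis less_le_trans powr_gt_zero less_irrefl)
    then have K0: "0 < K" using base_prod_pos[OF Q, of n] by (simp add: zero_less_mult_iff)
    have "\<bar>psi P Q x - psi P Q y\<bar> \<le> 1 / base_prod Q n"
      using cantor_value_diff_le[OF Q Q_digit[OF x] Q_digit[OF y] eq, of n]
        cantor_value_diff_le[OF Q Q_digit[OF y] Q_digit[OF x] eq', of n]
      by (simp add: psi x y abs_le_iff)
    also have "\<dots> \<le> K / base_prod P (n + k + 2) powr \<alpha>"
      using K[of n] base_prod_pos[OF Q, of n] base_prod_pos[OF P, of "n + k + 2"]
      by (simp add: field_simps)
    also have "\<dots> = K * (1 / base_prod P (n + k + 2)) powr \<alpha>"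
      using base_prod_pos[OF P, of "n + k + 2"] by (simp add: powr_divide)
    also have "\<dots> \<le> K * \<bar>x - y\<bar> powr \<alpha>"
      using gap pos \<alpha> K0 by (intro mult_left_mono powr_mono2) auto
    finally show ?thesis .
  qed
  show ?thesis
  proof (cases "?D x = ?D y")
    case True
    with val[OF x] val[OF y] have "x = y" by metis
    then show ?thesis by simp
  next
    case False
    then have "\<exists>n. ?D x n \<noteq> ?D y n" by auto
    from exists_least_iff[THEN iffD1, OF this]
    obtain n where n: "?D x n \<noteq> ?D y n" "\<And>m. m < n \<Longrightarrow> ?D x m = ?D y m" by blast
    then consider "?D x n < ?D y n" | "?D y n < ?D x n" by linarith
    then show ?thesis
    proof cases
      case 2
      then show ?thesis using main[OF y x _ 2] n(2) by (simp add: abs_minus_commute)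
    qed (use main[OF x y n(2)] in simp)
  qed
qed

section \<open>Growth of the base products\<close>

lemma space_basic:
  assumes "sets M = sets basic_sequence_space"
  shows "space M = basic_sequences"
  using sets_eq_imp_space_eq[OF assms] by (simp add: basic_sequence_space_def space_restrict_space)

lemma left_shift_funpow: "(left_shift ^^ k) P n = P (n + k)"
  by (induction k arbitrary: n) (auto simp: left_shift_def)

lemma measurable_left_shift:
  assumes "sets M = sets basic_sequence_space"
  shows "left_shift \<in> measurable M M"
proof -
  have "continuous_on UNIV left_shift"
    unfolding left_shift_def
    by (intro continuous_on_coordinatewise_then_product continuous_on_product_coordinates)
  then have "left_shift \<in> measurable borel borel" by (rule borel_measurable_continuous_onI)
  then have "left_shift \<in> measurable basic_sequence_space basic_sequence_space"
    unfolding basic_sequence_space_def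
    by (intro measurable_restrict_space3) (auto simp: basic_sequences_def left_shift_def)
  then show ?thesis using measurable_cong_sets[OF assms assms] by simp
qed

lemma measurable_ln_digit:
  assumes "sets M = sets basic_sequence_space"
  shows "(\<lambda>P. ln (real (P 0))) \<in> borel_measurable M"
proof -
  have "(\<lambda>P::nat \<Rightarrow> nat. P 0) \<in> borel_measurable borel"
    by (intro borel_measurable_continuous_onI continuous_on_product_coordinates)
  moreover have "(\<lambda>n::nat. ln (real n)) \<in> borel_measurable borel"
    by (intro borel_measurable_continuous_onI) simp
  ultimately have "(\<lambda>P::nat \<Rightarrow> nat. ln (real (P 0))) \<in> borel_measurable borel"
    by (rule measurable_compose)
  then have "(\<lambda>P::nat \<Rightarrow> nat. ln (real (P 0))) \<in> borel_measurable basic_sequence_space"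
    unfolding basic_sequence_space_def by (rule measurable_restrict_space1)
  then show ?thesis using measurable_cong_sets[OF assms refl] by blast
qed

lemma distr_left_shift:
  assumes "sets M = sets basic_sequence_space" and "shift_invariant M"
  shows "distr M M left_shift = M"
proof (rule measure_eqI)
  fix A assume "A \<in> sets (distr M M left_shift)"
  then show "emeasure (distr M M left_shift) A = emeasure M A"
    using assms by (simp add: emeasure_distr[OF measurable_left_shift] shift_invariant_def)
qed simp

text \<open>Mixing an invariant \<open>A\<close> with itself averages the constant |m - m^2| with m
  = \<open>measure M A\<close>; the limit 0 forces m = m^2.\<close>

lemma weakly_mixing_ergodic:
  assumes wm: "weakly_mixing M" and A: "A \<in> sets M" and inv: "left_shift -` A \<inter> space M = A"
    and T: "left_shift \<in> measurable M M"
  shows "measure M A = 0 \<or> measure M A = 1"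
proof -
  have "A \<subseteq> space M" using A by (rule sets.sets_into_space)
  \<comment> \<open>The preimages in \<open>weakly_mixing\<close> are not cut down to the space;
    intersecting with \<open>A\<close> keeps them inside it, so invariance applies at each
    iterate.\<close>
  then have "(left_shift ^^ k) -` A \<inter> A = A" for k
  proof (induction k)
    case (Suc k)
    have "(left_shift ^^ Suc k) P \<in> A" if "P \<in> A" for P
      using Suc inv that by (auto simp: funpow_swap1)
    then show ?case by blast
  qed simp
  then have "(\<lambda>n. (\<Sum>k<n. \<bar>measure M A - measure M A * measure M A\<bar>) / real n) \<longlonglongrightarrow> 0"
    using wm[unfolded weakly_mixing_def, rule_format, OF A A] by simp
  moreover have "(\<lambda>n. (\<Sum>k<n. \<bar>measure M A - measure M A * measure M A\<bar>) / real n)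
      \<longlonglongrightarrow> \<bar>measure M A - measure M A * measure M A\<bar>"
    \<comment> \<open>The mean is constant from \<open>n = 1\<close> on; at \<open>n = 0\<close> the
      quotient is 0 by convention.\<close>
    by (rule tendsto_eventually) (rule eventually_sequentiallyI[of 1], simp)
  ultimately have "\<bar>measure M A - measure M A * measure M A\<bar> = 0"
    using LIMSEQ_unique by blast
  then have "measure M A * (1 - measure M A) = 0" by (simp add: algebra_simps)
  then show ?thesis by auto
qed

text \<open>Along a shift orbit the first entry runs through all entries, so Birkhoff sums of a
  function of the first entry are sums over the sequence.\<close>

lemma AE_bdd_above_digit_sums:
  assumes M: "prob_space M" and sets: "sets M = sets basic_sequence_space" and inv: "shift_invariant M" and wm: "weakly_mixing M"
    and int: "integrable M (\<lambda>P. f (P 0))" and neg: "(\<integral>P. f (P 0) \<partial>M) < 0"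
  shows "AE P in M. \<exists>C. \<forall>n. (\<Sum>k<n. f (P k)) \<le> (C::real)"
proof -
  interpret prob_space M by fact
  note T = measurable_left_shift[OF sets]
  have "AE P in M. bdd_above (range (\<lambda>n. birkhoff_sum left_shift (\<lambda>P. f (P 0)) n P))"
    by (rule AE_bdd_above_birkhoff_sum[OF T distr_left_shift[OF sets inv] _ int neg])
      (rule weakly_mixing_ergodic[OF wm _ _ T])
  then show ?thesis
    by (rule AE_mp) (auto simp: birkhoff_sum_def left_shift_funpow bdd_above_def)
qed

lemma ln_base_prod:
  assumes "P \<in> basic_sequences"
  shows "ln (base_prod P n) = (\<Sum>k<n. ln (real (P k)))"
  unfolding base_prod_def
  using base_ge_2[OF assms] by (intro ln_prod) (auto intro: less_le_trans[of 0 2])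

text \<open>Centering at \<open>c\<close> strictly above the mean gives terms with negative
  integral. This margin is why the error is a constant and not merely sublinear.\<close>

lemma AE_base_prod_le:
  assumes M: "prob_space M" and "sets M = sets basic_sequence_space" "shift_invariant M" "weakly_mixing M"
    and int: "integrable M (\<lambda>P. ln (real (P 0)))" and less: "(\<integral>P. ln (real (P 0)) \<partial>M) < c"
  shows "AE P in M. \<exists>C. \<forall>n. ln (base_prod P n) \<le> c * real n + C"
proof -
  interpret prob_space M by fact
  have "AE P in M. \<exists>C. \<forall>n. (\<Sum>k<n. ln (real (P k)) - c) \<le> C"
    by (rule AE_bdd_above_digit_sums[OF assms(1-4), of "\<lambda>d. ln (real d) - c"])
      (use int less in \<open>simp_all add: prob_space\<close>)
  with AE_space show ?thesis
  proof eventually_elim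
    case (elim P)
    then obtain C where "\<And>n. (\<Sum>k<n. ln (real (P k)) - c) \<le> C" by blast
    then show ?case
      using elim(1) by (intro exI[of _ C]) (simp add: space_basic[OF assms(2)] ln_base_prod sum_subtractf algebra_simps)
  qed
qed

lemma AE_base_prod_ge:
  assumes M: "prob_space M" and "sets M = sets basic_sequence_space" "shift_invariant M" "weakly_mixing M"
    and int: "integrable M (\<lambda>P. ln (real (P 0)))" and less: "c < (\<integral>P. ln (real (P 0)) \<partial>M)"
  shows "AE P in M. \<exists>C. \<forall>n. c * real n - C \<le> ln (base_prod P n)"
proof -
  interpret prob_space M by fact
  have "AE P in M. \<exists>C. \<forall>n. (\<Sum>k<n. c - ln (real (P k))) \<le> C"
    by (rule AE_bdd_above_digit_sums[OF assms(1-4), of "\<lambda>d. c - ln (real d)"])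
      (use int less in \<open>simp_all add: prob_space\<close>)
  with AE_space show ?thesis
  proof eventually_elim
    case (elim P)
    then obtain C where "\<And>n. (\<Sum>k<n. c - ln (real (P k))) \<le> C" by blast
    then show ?case
      using elim(1) by (intro exI[of _ C]) (simp add: space_basic[OF assms(2)] ln_base_prod sum_subtractf algebra_simps)
  qed
qed

section \<open>Transfer to the product measure\<close>

lemma distr_pair_snd:
  assumes "prob_space M" and "prob_space N"
  shows "distr (M \<Otimes>\<^sub>M N) N snd = N"
proof (rule measure_eqI)
  interpret M: prob_space M by fact
  interpret N: prob_space N by fact
  fix A assume "A \<in> sets (distr (M \<Otimes>\<^sub>M N) N snd)"
  then have A: "A \<in> sets N" by simp
  have "snd -` A \<inter> space (M \<Otimes>\<^sub>M N) = space M \<times> A"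
    using sets.sets_into_space[OF A] by (auto simp: space_pair_measure)
  then show "emeasure (distr (M \<Otimes>\<^sub>M N) N snd) A = emeasure N A"
    using A by (simp add: emeasure_distr N.emeasure_pair_measure_Times M.emeasure_space_1)
qed simp

text \<open>Supplies the hypothesis of \<open>psi_hoelder_bound\<close>. The growth constants of the
  two factors do not involve \<open>k\<close>, so a single null set serves every
  \<open>k\<close>.\<close>

lemma AE_base_prod_powr_le:
  assumes M: "prob_space M" "sets M = sets basic_sequence_space" "shift_invariant M" "weakly_mixing M"
      "integrable M (\<lambda>P. ln (real (P 0)))"
    and N: "prob_space N" "sets N = sets basic_sequence_space" "shift_invariant N" "weakly_mixing N"
      "integrable N (\<lambda>P. ln (real (P 0)))"
    and \<alpha>: "0 < \<alpha>" and less: "\<alpha> * (\<integral>P. ln (real (P 0)) \<partial>M) < (\<integral>Q. ln (real (Q 0)) \<partial>N)"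
  shows "AE (P, Q) in M \<Otimes>\<^sub>M N. P \<in> basic_sequences \<and> Q \<in> basic_sequences \<and>
    (\<forall>k. \<exists>K>0. \<forall>n. base_prod P (n + k + 2) powr \<alpha> \<le> K * base_prod Q n)"
proof -
  interpret M: prob_space M by fact
  interpret N: prob_space N by fact
  interpret pair_prob_space M N ..
  let ?a = "\<integral>P. ln (real (P 0)) \<partial>M" and ?b = "\<integral>Q. ln (real (Q 0)) \<partial>N"
  \<comment> \<open>Chosen to solve \<open>\<alpha> * (?a + e) = ?b - e\<close>: both means are
    relaxed by the same \<open>e\<close> until the two linear growth rates agree.\<close>
  define e where "e = (?b - \<alpha> * ?a) / (1 + \<alpha>)"
  have e: "0 < e" "\<alpha> * (?a + e) = ?b - e"
    unfolding e_def using \<alpha> less by (auto simp: field_simps)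
  have "AE P in M. \<exists>C. \<forall>n. ln (base_prod P n) \<le> (?a + e) * real n + C"
    by (rule AE_base_prod_le[OF M]) (use e in simp)
  \<comment> \<open>The null set of a factor is pulled back along the projection, whose image
    measure is that factor.\<close>
  then have "AE P in distr (M \<Otimes>\<^sub>M N) M fst. \<exists>C. \<forall>n. ln (base_prod P n) \<le> (?a + e) * real n + C"
    unfolding N.distr_pair_fst .
  then have fst: "AE \<omega> in M \<Otimes>\<^sub>M N. \<exists>C. \<forall>n. ln (base_prod (fst \<omega>) n) \<le> (?a + e) * real n + C"
    by (rule AE_distrD[rotated]) simp
  have "AE Q in N. \<exists>C. \<forall>n. (?b - e) * real n - C \<le> ln (base_prod Q n)"
    by (rule AE_base_prod_ge[OF N]) (use e in simp)
  then have "AE Q in distr (M \<Otimes>\<^sub>M N) N snd. \<exists>C. \<forall>n. (?b - e) * real n - C \<le> ln (base_prod Q n)"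
    unfolding distr_pair_snd[OF M(1) N(1)] .
  then have snd: "AE \<omega> in M \<Otimes>\<^sub>M N. \<exists>C. \<forall>n. (?b - e) * real n - C \<le> ln (base_prod (snd \<omega>) n)"
    by (rule AE_distrD[rotated]) simp
  from fst snd AE_space show ?thesis
  proof eventually_elim
    case (elim \<omega>)
    obtain P Q where \<omega>: "\<omega> = (P, Q)" by fastforce
    have P: "P \<in> basic_sequences" and Q: "Q \<in> basic_sequences"
      using elim(3) by (auto simp: \<omega> space_pair_measure space_basic M(2) N(2))
    obtain C where C: "\<And>n. ln (base_prod P n) \<le> (?a + e) * real n + C" using elim(1) \<omega> by auto
    obtain D where D: "\<And>n. (?b - e) * real n - D \<le> ln (base_prod Q n)" using elim(2) \<omega> by auto
    have "base_prod P (n + k + 2) powr \<alpha> \<le> exp (\<alpha> * (?a + e) * real (k + 2) + \<alpha> * C + D) * base_prod Q n"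
      for n k
    proof -
      have "\<alpha> * ln (base_prod P (n + k + 2)) \<le> \<alpha> * ((?a + e) * real (n + k + 2) + C)"
        using C[of "n + k + 2"] \<alpha> by (intro mult_left_mono) simp_all
      \<comment> \<open>Since the rates agree, the part linear in \<open>n\<close> is absorbed by
        \<open>ln (base_prod Q n)\<close>; the \<open>k + 2\<close> surplus places go into the
        constant.\<close>
      also have "\<dots> = (\<alpha> * (?a + e) * real (k + 2) + \<alpha> * C + D) + (\<alpha> * (?a + e) * real n - D)"
        by (simp add: algebra_simps)
      also have "\<dots> \<le> (\<alpha> * (?a + e) * real (k + 2) + \<alpha> * C + D) + ln (base_prod Q n)"
        using D[of n] unfolding e(2) by simp
      finally have "exp (\<alpha> * ln (base_prod P (n + k + 2)))
          \<le> exp ((\<alpha> * (?a + e) * real (k + 2) + \<alpha> * C + D) + ln (base_prod Q n))"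
        by simp
      then show ?thesis
        using base_prod_pos[OF P, of "n + k + 2"] base_prod_pos[OF Q, of n]
        by (simp add: powr_def exp_add)
    qed
    then show ?case using P Q \<omega> by (auto intro!: exI[of _ "exp _"])
  qed
qed

text \<open>\<open>ennreal\<close> sends negative reals to 0, but entries are at least 2, so the
  logarithms are nonnegative and the extended integral agrees with the Bochner integral.\<close>

lemma nn_integral_ln_digit:
  assumes sets: "sets M = sets basic_sequence_space"
    and fin: "(\<integral>\<^sup>+P. ennreal (ln (real (P 0))) \<partial>M) < \<infinity>"
  shows "integrable M (\<lambda>P. ln (real (P 0)))"
    and "(\<integral>\<^sup>+P. ennreal (ln (real (P 0))) \<partial>M) = ennreal (\<integral>P. ln (real (P 0)) \<partial>M)"
    and "0 \<le> (\<integral>P. ln (real (P 0)) \<partial>M)"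
proof -
  have nonneg: "0 \<le> ln (real (P 0))" if "P \<in> space M" for P
    using that base_ge_2[of P 0] by (simp add: space_basic[OF sets])
  then show int: "integrable M (\<lambda>P. ln (real (P 0)))"
    using measurable_ln_digit[OF sets] fin by (intro integrableI_nonneg AE_I2) auto
  show "(\<integral>\<^sup>+P. ennreal (ln (real (P 0))) \<partial>M) = ennreal (\<integral>P. ln (real (P 0)) \<partial>M)"
    using int nonneg by (intro nn_integral_eq_integral AE_I2) auto
  show "0 \<le> (\<integral>P. ln (real (P 0)) \<partial>M)"
    using nonneg by (rule Bochner_Integration.integral_nonneg)
qed

theorem theorem2p39:
  fixes \<mu>1 \<mu>2 :: "(nat \<Rightarrow> nat) measure"
    and \<mu> :: "((nat \<Rightarrow> nat) \<times> (nat \<Rightarrow> nat)) measure"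
    and \<alpha> :: real
  assumes "prob_space \<mu>1" and "sets \<mu>1 = sets basic_sequence_space"
    and "prob_space \<mu>2" and "sets \<mu>2 = sets basic_sequence_space"
    and "shift_invariant \<mu>1" and "shift_invariant \<mu>2"
    and "weakly_mixing \<mu>1" and "weakly_mixing \<mu>2"
    and "\<not> positive_on \<mu>1 {2}" and "\<not> positive_on \<mu>2 {2}"
    and "\<mu> = \<mu>1 \<Otimes>\<^sub>M \<mu>2"
    and "0 < \<alpha>" and "\<alpha> < 1"
    and "max (\<integral>\<^sup>+\<omega>. ennreal (ln (real (pi1 \<omega>))) \<partial>\<mu>) (\<integral>\<^sup>+\<omega>. ennreal (ln (real (pi2 \<omega>))) \<partial>\<mu>) < \<infinity>"
  shows "((\<integral>\<^sup>+\<omega>. ennreal (ln (real (pi2 \<omega>))) \<partial>\<mu>) > ennreal \<alpha> * (\<integral>\<^sup>+\<omega>. ennreal (ln (real (pi1 \<omega>))) \<partial>\<mu>) \<longrightarrow>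
           (AE (P, Q) in \<mu>. \<forall>k. hoelder_on \<alpha> (Z_set P Q k) (phi P Q k)))
       \<and> ((\<integral>\<^sup>+\<omega>. ennreal (ln (real (pi2 \<omega>))) \<partial>\<mu>) > (\<integral>\<^sup>+\<omega>. ennreal (ln (real (pi1 \<omega>))) \<partial>\<mu>) \<longrightarrow>
           (AE (P, Q) in \<mu>. \<forall>k. \<exists>C. C-lipschitz_on (Z_set P Q k) (phi P Q k)))"
proof -
  interpret M: prob_space \<mu>1 by fact
  interpret N: prob_space \<mu>2 by fact
  let ?L = "\<lambda>P::nat \<Rightarrow> nat. ennreal (ln (real (P 0)))"
  let ?a = "\<integral>P. ln (real (P 0)) \<partial>\<mu>1" and ?b = "\<integral>Q. ln (real (Q 0)) \<partial>\<mu>2"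
  \<comment> \<open>The integral of a function of one coordinate descends to the marginal
    measure.\<close>
  have "(\<integral>\<^sup>+P. ?L P \<partial>distr (\<mu>1 \<Otimes>\<^sub>M \<mu>2) \<mu>1 fst) = (\<integral>\<^sup>+\<omega>. ?L (fst \<omega>) \<partial>(\<mu>1 \<Otimes>\<^sub>M \<mu>2))"
    using measurable_ln_digit[OF assms(2)] by (intro nn_integral_distr) auto
  then have a: "(\<integral>\<^sup>+\<omega>. ennreal (ln (real (pi1 \<omega>))) \<partial>\<mu>) = (\<integral>\<^sup>+P. ?L P \<partial>\<mu>1)"
    by (simp add: N.distr_pair_fst pi1_def \<open>\<mu> = _\<close>)
  have "(\<integral>\<^sup>+Q. ?L Q \<partial>distr (\<mu>1 \<Otimes>\<^sub>M \<mu>2) \<mu>2 snd) = (\<integral>\<^sup>+\<omega>. ?L (snd \<omega>) \<partial>(\<mu>1 \<Otimes>\<^sub>M \<mu>2))"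
    using measurable_ln_digit[OF assms(4)] by (intro nn_integral_distr) auto
  then have b: "(\<integral>\<^sup>+\<omega>. ennreal (ln (real (pi2 \<omega>))) \<partial>\<mu>) = (\<integral>\<^sup>+Q. ?L Q \<partial>\<mu>2)"
    by (simp add: distr_pair_snd[OF assms(1,3)] pi2_def \<open>\<mu> = _\<close>)
  have "(\<integral>\<^sup>+P. ?L P \<partial>\<mu>1) < \<infinity>" "(\<integral>\<^sup>+Q. ?L Q \<partial>\<mu>2) < \<infinity>"
    using assms(14) unfolding a b by auto
  note M = nn_integral_ln_digit[OF assms(2) this(1)] and N = nn_integral_ln_digit[OF assms(4) this(2)]
  \<comment> \<open>Both conclusions are instances, with \<open>\<beta>\<close> equal to
    \<open>\<alpha>\<close> or to 1. \<open>K > 0\<close> is recorded because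
    \<open>lipschitz_on\<close> demands a nonnegative constant.\<close>
  have bound: "AE (P, Q) in \<mu>. \<forall>k. \<exists>K>0. \<forall>x\<in>Z_set P Q k. \<forall>y\<in>Z_set P Q k.
      \<bar>phi P Q k x - phi P Q k y\<bar> \<le> K * \<bar>x - y\<bar> powr \<beta>"
    if "0 < \<beta>" "\<beta> * ?a < ?b" for \<beta>
    using AE_base_prod_powr_le[OF assms(1,2,5,7) M(1) assms(3,4,6,8) N(1) that]
    unfolding \<open>\<mu> = _\<close>
  proof eventually_elim
    case (elim \<omega>)
    then show ?case
      using psi_hoelder_bound[OF _ _ \<open>0 < \<beta>\<close>] by (auto simp: phi_def) metis
  qed
  show ?thesis
  proof (intro conjI impI)
    assume "(\<integral>\<^sup>+\<omega>. ennreal (ln (real (pi2 \<omega>))) \<partial>\<mu>) > ennreal \<alpha> * (\<integral>\<^sup>+\<omega>. ennreal (ln (real (pi1 \<omega>))) \<partial>\<mu>)"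
    then have "\<alpha> * ?a < ?b"
      unfolding a b using M N \<open>0 < \<alpha>\<close> by (simp add: ennreal_mult[symmetric] ennreal_less_iff)
    from bound[OF \<open>0 < \<alpha>\<close> this]
    show "AE (P, Q) in \<mu>. \<forall>k. hoelder_on \<alpha> (Z_set P Q k) (phi P Q k)"
      by (rule AE_mp) (auto simp: hoelder_on_def intro!: AE_I2, metis)
  next
    assume "(\<integral>\<^sup>+\<omega>. ennreal (ln (real (pi2 \<omega>))) \<partial>\<mu>) > (\<integral>\<^sup>+\<omega>. ennreal (ln (real (pi1 \<omega>))) \<partial>\<mu>)"
    \<comment> \<open>The factor 1 matches \<open>bound\<close> at exponent 1, where
      \<open>powr\<close> returns the distance itself.\<close>
    then have "1 * ?a < ?b"
      unfolding a b using M N by (simp add: ennreal_less_iff)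
    from bound[OF zero_less_one this]
    show "AE (P, Q) in \<mu>. \<forall>k. \<exists>C. C-lipschitz_on (Z_set P Q k) (phi P Q k)"
      by (rule AE_mp) (auto simp: lipschitz_on_def dist_real_def intro!: AE_I2, meson less_imp_le)
  qed
qed

end
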